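(* Let $k\in\mathbb{N}$ and let $z_\tau \in \mathbb{V}_k^c(I_\tau;X)$, with values in $D$, be a solution of the following scheme: $z_\tau(0)=z_0$ and, for all $i=1,\dots,m$ and all $\phi\in\mathcal{P}_{k-1}(I_i;X)$, $$\int_{t_{i-1}}^{t_i} \langle \partial_t z_\tau,\phi\rangle\,\mathrm{d}t = Q_i\left[\, j(\Pi\eta(z_\tau),\phi) - r(\Pi\eta(z_\tau),\phi) + b(\cdot,\Pi\eta(z_\tau),\phi)\,\right].$$ Assume that $\eta(z_\tau)\in C(I;X)$. Then, for all $i=1,\dots,m$, $$\mathcal{H}(z_\tau(t_i))-\mathcal{H}(z_\tau(t_{i-1})) = Q_i\left[-r(\Pi\eta(z_\tau),\Pi\eta(z_\tau)) + b(\cdot,\Pi\eta(z_\tau),\Pi\eta(z_\tau))\right] \le Q_i\left[\,b(\cdot,\Pi\eta(z_\tau),\Pi\eta(z_\tau))\,\right].$$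
   Context: Spaces. $Z$ is a separable (real) Hilbert space identified with its dual, with inner product $\langle\cdot,\cdot\rangle$. $X$ is a reflexive Banach space with continuous and dense embedding $X\hookrightarrow Z$, so that $X\hookrightarrow Z\cong Z'\hookrightarrow X'$ and $\langle v,w\rangle_{X',X}=\langle v,w\rangle$ for $v\in Z$, $w\in X$. $I=[0,T]$ with $T>0$, and $z_0\in X$ is a given initial datum. Hamiltonian. $Y$ is a Banach space continuously embedded in $X$, $D\subset Y$ is open, and $\mathcal{H}\in C^1(D;\mathbb{R})$, i.e. $\mathcal{H}$ is Fréchet differentiable on $D$ and $v\mapsto\mathcal{H}'(v)\in Y'$ is continuous on $D$. Put $\eta:=\mathcal{H}'$. For $v\in D$, saying $\eta(v)\in X$ means that $\eta(v)\in Y'$ is represented by an element of $X$ (again written $\eta(v)$) through the inner product of $Z$: $\mathcal{H}'(v)[y]=\langle \eta(v),y\rangle$ for all $y\in Y$. The condition $\eta(z_\tau)\in C(I;X)$ means that $t\mapsto\eta(z_\tau(t))$ is (represented by) a continuous function $I\to X$. Functionals. $j,r\colon X\times X\to\mathbb{R}$ and $b\colon I\times X\times X\to\mathbb{R}$ are linear and Lipschitz continuous in their last argument and continuous in the remaining arguments. There are $p\in(1,\infty)$, $\mathfrak{b}\in C(I)$ and $c>0$ such that $|j(v,w)|+|r(v,w)|+|b(t,v,w)|\le c(\mathfrak{b}(t)+\|v\|_X^{p-1})\|w\|_X$ for all $v,w\in X$, $t\in I$. Moreover $j(v,v)=0$ and $r(v,v)\ge 0$ for all $v\in X$. Time discretization.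 $0=t_0<t_1<\dots<t_m=T$, $I_i=[t_{i-1},t_i]$, $\tau_i=t_i-t_{i-1}$, $I_\tau=\{I_1,\dots,I_m\}$. For a Banach space $B$ and $l\in\mathbb{N}_0$, $\mathcal{P}_l(I_i;B)$ is the set of polynomials of degree at most $l$ from $I_i$ to $B$; $\mathbb{V}_l(I_\tau;B)=\{z\in L^\infty(I;B): z|_{I_i}\in\mathcal{P}_l(I_i;B)\ \text{for all } i\}$; $\mathbb{V}^c_l(I_\tau;B)=\mathbb{V}_l(I_\tau;B)\cap C(I;B)$. The derivative $\partial_t z_\tau$ is taken piecewise on each $I_i$. Quadrature. For given $s_Q\in\mathbb{N}$, weights $\omega_j>0$ with $\sum_{j=1}^{s_Q}\omega_j=1$, and nodes $\zeta^i_j\in I_i$ (the images in $I_i$ of the nodes of a fixed quadrature formula on $[0,1]$), $Q_i\colon C(I_i)\to\mathbb{R}$ is $Q_i(g)=\tau_i\sum_{j=1}^{s_Q}\omega_j\,g(\zeta_j^i)$. No exactness of $Q_i$ is assumed. When $Q_i$ is applied to an expression built from piecewise polynomials, their restrictions to $I_i$ (polynomials on the closed interval $I_i$) are used. Projection. $\Pi\colon L^2(I;Z)\to\mathbb{V}_{k-1}(I_\tau;Z)$ is the $L^2$-projection: $\int_0^T\langle(\Pi f)(t),g(t)\rangle\,\mathrm{d}t=\int_0^T\langle f(t),g(t)\rangle\,\mathrm{d}t$ for all $g\in\mathbb{V}_{k-1}(I_\tau;Z)$. It acts locally on each $I_i$ and maps $L^2(I;X)$ into $\mathbb{V}_{k-1}(I_\tau;X)$.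 *)

theory Defs
  imports "HOL-Analysis.Analysis"
begin

text \<open>Distinct Banach spaces are distinct types, so an inclusion of one space in another is
  an explicit map between the types.\<close>

definition cont_embedding :: "('a::real_normed_vector \<Rightarrow> 'b::real_normed_vector) \<Rightarrow> bool" where
  "cont_embedding e \<longleftrightarrow> bounded_linear e \<and> inj e"

definition dense_embedding :: "('a::real_normed_vector \<Rightarrow> 'b::real_normed_vector) \<Rightarrow> bool" where
  "dense_embedding e \<longleftrightarrow> cont_embedding e \<and> closure (range e) = UNIV"

text \<open>Surjectivity of the canonical map into the bidual.\<close>

definition reflexive_space :: "'a::real_normed_vector itself \<Rightarrow> bool" where
  "reflexive_space _ \<longleftrightarrow>
     (\<forall>F :: ('a \<Rightarrow>\<^sub>L real) \<Rightarrow>\<^sub>L real. \<exists>x::'a. \<forall>f. blinfun_apply F f = blinfun_apply f x)"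

text \<open>The time grid is a sequence \<open>t 0 < t 1 < \<dots> < t m\<close>; only these values are used.\<close>

definition cell :: "(nat \<Rightarrow> real) \<Rightarrow> nat \<Rightarrow> real set" where
  "cell t i = {t (i - 1)..t i}"

text \<open>Functions whose values on \<open>S\<close> are those of a polynomial of degree at most \<open>l\<close>; their
  values outside \<open>S\<close> are arbitrary.\<close>

definition poly_maps :: "nat \<Rightarrow> real set \<Rightarrow> (real \<Rightarrow> 'b::real_normed_vector) set" where
  "poly_maps l S = {f. \<exists>c. \<forall>s\<in>S. f s = (\<Sum>n\<le>l. s ^ n *\<^sub>R c n)}"

text \<open>Representatives of the classes in \<open>L\<^sup>\<infinity>\<close> that are polynomial on each cell. Being Lebesgue
  measurable and essentially bounded is automatic, and the values at the grid points, where the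
  one-sided limits may differ, are irrelevant.\<close>

definition pw_poly ::
    "(nat \<Rightarrow> real) \<Rightarrow> nat \<Rightarrow> nat \<Rightarrow> (real \<Rightarrow> 'b::real_normed_vector) set" where
  "pw_poly t m l =
     {f. \<forall>i\<in>{1..m}. \<exists>p\<in>poly_maps l (cell t i). AE s in lebesgue_on (cell t i). f s = p s}"

definition pw_poly_cont ::
    "(nat \<Rightarrow> real) \<Rightarrow> nat \<Rightarrow> nat \<Rightarrow> (real \<Rightarrow> 'b::real_normed_vector) set" where
  "pw_poly_cont t m l = pw_poly t m l \<inter> {f. continuous_on {t 0..t m} f}"

text \<open>The restriction of the class of \<open>f\<close> to a nondegenerate interval \<open>S\<close>, as a polynomial on
  \<open>S\<close>; its values on \<open>S\<close> do not depend on the choice.\<close>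

definition poly_restrict ::
    "nat \<Rightarrow> real set \<Rightarrow> (real \<Rightarrow> 'b::real_normed_vector) \<Rightarrow> real \<Rightarrow> 'b" where
  "poly_restrict l S f = (SOME p. p \<in> poly_maps l S \<and> (AE s in lebesgue_on S. f s = p s))"

text \<open>The \<open>L\<^sup>2\<close>-projection onto piecewise polynomials of degree at most \<open>l\<close>, meaningful for
  square integrable \<open>f\<close>. The choice is one of a representative: the class is unique.\<close>

definition L2_proj ::
    "(nat \<Rightarrow> real) \<Rightarrow> nat \<Rightarrow> nat \<Rightarrow> (real \<Rightarrow> 'z::real_inner) \<Rightarrow> real \<Rightarrow> 'z" where
  "L2_proj t m l f =
     (SOME g. g \<in> pw_poly t m l \<and>
        (\<forall>h\<in>pw_poly t m l.
           (\<integral>s. g s \<bullet> h s \<partial>lebesgue_on {t 0..t m}) = (\<integral>s. f s \<bullet> h s \<partial>lebesgue_on {t 0..t m})))"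

text \<open>For \<open>f\<close> with values in the subspace \<open>X\<close> of \<open>Z\<close> (embedded by \<open>e\<close>), the projection of \<open>f\<close>,
  restricted to the \<open>i\<close>-th cell and regarded as a polynomial with values in \<open>X\<close>. It is formed
  in \<open>Z\<close> and pulled back, which is legitimate since it takes values in \<open>range e\<close>.\<close>

definition proj_cell ::
    "('x::real_normed_vector \<Rightarrow> 'z::real_inner) \<Rightarrow> (nat \<Rightarrow> real) \<Rightarrow> nat \<Rightarrow> nat \<Rightarrow>
     (real \<Rightarrow> 'x) \<Rightarrow> nat \<Rightarrow> real \<Rightarrow> 'x" where
  "proj_cell e t m l f i s = inv e (poly_restrict l (cell t i) (L2_proj t m l (\<lambda>u. e (f u))) s)"

text \<open>The quadrature formula on \<open>[0,1]\<close> with \<open>q\<close> weights \<open>\<omega>\<close> and nodes \<open>\<zeta>\<close>, transported to the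
  \<open>i\<close>-th cell.\<close>

definition quad ::
    "(nat \<Rightarrow> real) \<Rightarrow> nat \<Rightarrow> (nat \<Rightarrow> real) \<Rightarrow> (nat \<Rightarrow> real) \<Rightarrow> nat \<Rightarrow> (real \<Rightarrow> real) \<Rightarrow> real" where
  "quad t q \<omega> \<zeta> i g =
     (t i - t (i - 1)) * (\<Sum>n=1..q. \<omega> n * g (t (i - 1) + (t i - t (i - 1)) * \<zeta> n))"

end

theory Submission
  imports Defs
begin

text \<open>On a single cell the energy balance is the chain rule followed by one use of the scheme. Since
\<open>z\<close> is a polynomial in time there, \<open>\<partial>\<^sub>t z\<close> is a polynomial of degree at most \<open>k - 1\<close>, and hence
\[
  H(z(t_i)) - H(z(t_{i-1})) = \int \langle \eta(z), \partial_t z\rangle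
    = \int \langle \Pi\eta(z), \partial_t z\rangle ,
\]
because the projection error is orthogonal to \<open>\<partial>\<^sub>t z\<close>. The projection \<open>\<Pi>\<eta>(z)\<close> is itself an
admissible test function of the scheme, which turns the last integral into the quadrature of
\<open>j(w,w) - r(w,w) + b(s,w,w)\<close> with \<open>w = \<Pi>\<eta>(z)\<close>. Here \<open>j(w,w)\<close> vanishes, and dropping
\<open>- r(w,w) \<le> 0\<close> at every node gives the inequality, as the weights are positive.

Two points behind this computation need an argument, both because a subspace carries a stronger
norm than the space around it.

First, the chain rule for \<open>H\<close> takes place in \<open>Y\<close>, whereas \<open>z\<close> is a polynomial with values in the
larger space \<open>X\<close> that merely happen to lie in \<open>Y\<close>. Differentiability in \<open>Y\<close> holds because the
coefficients of \<open>z\<close> lie in \<open>Y\<close> as well; this is pure algebra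
(\<open>poly_maps_factor_through_subspace\<close>), and \<open>hamiltonian_increment\<close> is the resulting fundamental
theorem of calculus.

Second, the projection is formed in \<open>Z\<close>, and to be a test function it must have values in
\<open>X\<close>. Let \<open>q\<^sub>0, q\<^sub>1, \<dots>\<close> be real polynomials dual to the monomials (\<open>moment_dual_basis\<close>). Then the
local projection is the sum of the \<open>q\<^sub>n\<close> times the moments of \<open>\<eta>(z)\<close>. These are integrals of
continuous \<open>X\<close>-valued functions, hence elements of \<open>X\<close> (\<open>poly_projection_on_interval\<close>). That the
global projection coincides with this formula on each cell is \<open>L2_proj_on_cell\<close>.\<close>

section \<open>Polynomial maps into a normed space\<close>

lemma poly_maps_continuous_on: "f \<in> poly_maps l S \<Longrightarrow> continuous_on S f"
proof -
  assume "f \<in> poly_maps l S"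
  then obtain c where c: "\<forall>s\<in>S. f s = (\<Sum>n\<le>l. s ^ n *\<^sub>R c n)"
    unfolding poly_maps_def by blast
  have "continuous_on S (\<lambda>s. \<Sum>n\<le>l. s ^ n *\<^sub>R c n)"
    by (intro continuous_intros)
  then show ?thesis
    using c by (metis (mono_tags, lifting) continuous_on_cong)
qed

lemma poly_maps_linear_image:
  assumes "linear e" "f \<in> poly_maps l S"
  shows "(\<lambda>s. e (f s)) \<in> poly_maps l S"
proof -
  obtain c where "\<forall>s\<in>S. f s = (\<Sum>n\<le>l. s ^ n *\<^sub>R c n)"
    using assms(2) unfolding poly_maps_def by blast
  then have "\<forall>s\<in>S. e (f s) = (\<Sum>n\<le>l. s ^ n *\<^sub>R e (c n))"
    using assms(1) by (simp add: linear_sum linear_scale)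
  then show ?thesis unfolding poly_maps_def by (auto intro!: exI[of _ "\<lambda>n. e (c n)"])
qed

lemma poly_maps_add:
  assumes "f \<in> poly_maps l S" "g \<in> poly_maps l S"
  shows "(\<lambda>s. f s + g s) \<in> poly_maps l S"
proof -
  obtain c d where "\<forall>s\<in>S. f s = (\<Sum>n\<le>l. s ^ n *\<^sub>R c n)" "\<forall>s\<in>S. g s = (\<Sum>n\<le>l. s ^ n *\<^sub>R d n)"
    using assms unfolding poly_maps_def by blast
  then have "\<forall>s\<in>S. f s + g s = (\<Sum>n\<le>l. s ^ n *\<^sub>R (c n + d n))"
    by (simp add: scaleR_add_right sum.distrib)
  then show ?thesis unfolding poly_maps_def by (auto intro!: exI[of _ "\<lambda>n. c n + d n"])
qed

lemma poly_maps_0: "(\<lambda>s. 0) \<in> poly_maps l S"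
  unfolding poly_maps_def by (auto intro!: exI[of _ "\<lambda>n. 0"])

lemma poly_maps_diff:
  assumes "f \<in> poly_maps l S" "g \<in> poly_maps l S"
  shows "(\<lambda>s. f s - g s) \<in> poly_maps l S"
  using poly_maps_add[OF assms(1) poly_maps_linear_image[OF _ assms(2), of uminus]]
  by (simp add: linear_uminus)

lemma poly_maps_sum:
  assumes "\<And>i. i \<in> A \<Longrightarrow> f i \<in> poly_maps l S"
  shows "(\<lambda>s. \<Sum>i\<in>A. f i s) \<in> poly_maps l S"
  using assms by (induction A rule: infinite_finite_induct) (auto intro: poly_maps_0 poly_maps_add)

lemma poly_scaleR_in_poly_maps:
  assumes "degree q \<le> l"
  shows "(\<lambda>s. poly q s *\<^sub>R v) \<in> poly_maps l S"
proof -
  have "poly q s = (\<Sum>n\<le>l. coeff q n * s ^ n)" for s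
    by (subst (1) poly_as_sum_of_monoms'[OF assms, symmetric]) (simp add: poly_sum poly_monom)
  then have "poly q s *\<^sub>R v = (\<Sum>n\<le>l. s ^ n *\<^sub>R (coeff q n *\<^sub>R v))" for s
    by (simp add: scaleR_sum_left mult.commute)
  then show ?thesis unfolding poly_maps_def by (auto intro!: exI[of _ "\<lambda>n. coeff q n *\<^sub>R v"])
qed

lemma poly_maps_cong:
  assumes "f \<in> poly_maps l S" "\<And>s. s \<in> S \<Longrightarrow> g s = f s"
  shows "g \<in> poly_maps l S"
  using assms unfolding poly_maps_def by simp

lemma poly_maps_times_linear_factor:
  fixes f :: "real \<Rightarrow> 'a::real_normed_vector"
  assumes "f \<in> poly_maps l S"
  shows "(\<lambda>s. (s - a) *\<^sub>R f s) \<in> poly_maps (Suc l) S"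
proof -
  obtain c where c: "\<forall>s\<in>S. f s = (\<Sum>n\<le>l. s ^ n *\<^sub>R c n)"
    using assms unfolding poly_maps_def by blast
  have "(\<lambda>s. \<Sum>n\<le>l. poly ([:- a, 1:] * monom 1 n) s *\<^sub>R c n) \<in> poly_maps (Suc l) S"
    by (intro poly_maps_sum poly_scaleR_in_poly_maps order_trans[OF degree_mult_le])
       (auto simp: degree_monom_eq)
  then show ?thesis
    by (rule poly_maps_cong)
      (use c in \<open>auto simp: scaleR_sum_right poly_monom algebra_simps intro!: sum.cong\<close>)
qed

text \<open>Synthetic division: each \<open>s\<^sup>n - a\<^sup>n\<close> is divisible by \<open>s - a\<close>, and the quotients are collected by
powers of \<open>s\<close>.\<close>

lemma poly_maps_divided_difference:
  fixes f :: "real \<Rightarrow> 'a::real_normed_vector"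
  assumes "f \<in> poly_maps (Suc l) UNIV"
  shows "\<exists>q\<in>poly_maps l UNIV. \<forall>s. f s = f a + (s - a) *\<^sub>R q s"
proof -
  obtain c where c: "\<And>s. f s = (\<Sum>n\<le>Suc l. s ^ n *\<^sub>R c n)"
    using assms unfolding poly_maps_def by blast
  define q where "q = (\<lambda>s. \<Sum>n\<le>l. \<Sum>p<Suc n. poly (monom (a ^ (n - p)) p) s *\<^sub>R c (Suc n))"
  have "q \<in> poly_maps l UNIV"
    unfolding q_def
    by (intro poly_maps_sum poly_scaleR_in_poly_maps order_trans[OF degree_monom_le]) auto
  moreover have "f s = f a + (s - a) *\<^sub>R q s" for s
  proof -
    have "f s - f a = (\<Sum>n\<le>Suc l. (s ^ n - a ^ n) *\<^sub>R c n)"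
      by (simp add: c sum_subtractf scaleR_diff_left del: sum.atMost_Suc)
    also have "\<dots> = (\<Sum>n\<le>l. (s ^ Suc n - a ^ Suc n) *\<^sub>R c (Suc n))"
      by (subst sum.atMost_Suc_shift) simp
    also have "\<dots> = (s - a) *\<^sub>R q s"
      unfolding diff_power_eq_sum q_def
      by (simp add: scaleR_sum_right scaleR_sum_left poly_monom mult.commute sum_distrib_left
          scaleR_add_left distrib_left scaleR_add_right del: sum.lessThan_Suc)
    finally show ?thesis by (simp add: algebra_simps)
  qed
  ultimately show ?thesis by blast
qed

text \<open>The range of \<open>e\<close> is any linear subspace, not necessarily closed, so the coefficients cannot be
recovered by limits or derivatives. Division by a linear factor is algebraic instead: if \<open>f\<close> takes
values in the subspace at infinitely many points, so does its divided difference at one of them,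
and its degree is smaller.\<close>

lemma poly_maps_factor_through_subspace:
  fixes e :: "'y::real_normed_vector \<Rightarrow> 'x::real_normed_vector"
  assumes "linear e" "infinite S" "f \<in> poly_maps l UNIV" "\<And>s. s \<in> S \<Longrightarrow> f s \<in> range e"
  shows "\<exists>g\<in>poly_maps l UNIV. \<forall>s. f s = e (g s)"
  using assms(2-4)
proof (induction l arbitrary: f S)
  case 0
  obtain c where c: "\<And>s. f s = c"
    using 0(2) unfolding poly_maps_def by auto
  obtain s where "s \<in> S" using 0(1) infinite_imp_nonempty by blast
  then obtain y where "c = e y" using 0(3) c by auto
  moreover have "(\<lambda>s. y) \<in> poly_maps 0 UNIV"
    unfolding poly_maps_def by (auto intro!: exI[of _ "\<lambda>n. y"])
  ultimately show ?case using c by (intro bexI[of _ "\<lambda>s. y"]) auto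
next
  case (Suc l)
  obtain a where a: "a \<in> S" using Suc.prems(1) infinite_imp_nonempty by blast
  obtain y where y: "f a = e y" using Suc.prems(3)[OF a] by auto
  obtain q where q: "q \<in> poly_maps l UNIV" "\<And>s. f s = f a + (s - a) *\<^sub>R q s"
    using poly_maps_divided_difference[OF Suc.prems(2), of a] by blast
  have "q s \<in> range e" if s: "s \<in> S - {a}" for s
  proof -
    obtain x where "f s = e x" using Suc.prems(3) s by auto
    then have "(s - a) *\<^sub>R q s = e (x - y)"
      using q(2)[of s] y by (simp add: linear_diff[OF assms(1)] add_diff_cancel_left' eq_diff_eq add.commute)
    then have "inverse (s - a) *\<^sub>R ((s - a) *\<^sub>R q s) = inverse (s - a) *\<^sub>R e (x - y)"
      by (rule arg_cong)
    then have "q s = inverse (s - a) *\<^sub>R e (x - y)" using s by simp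
    also have "\<dots> = e (inverse (s - a) *\<^sub>R (x - y))"
      by (simp add: linear_scale[OF assms(1)])
    finally show ?thesis by blast
  qed
  then obtain g where g: "g \<in> poly_maps l UNIV" "\<And>s. q s = e (g s)"
    using Suc.IH[of "S - {a}" q] Suc.prems(1) q(1) by auto
  have "(\<lambda>s. poly [:1:] s *\<^sub>R y + (s - a) *\<^sub>R g s) \<in> poly_maps (Suc l) UNIV"
    by (intro poly_maps_add poly_scaleR_in_poly_maps poly_maps_times_linear_factor g) auto
  moreover have "f s = e (poly [:1:] s *\<^sub>R y + (s - a) *\<^sub>R g s)" for s
    using q(2)[of s] y g(2)[of s]
    by (simp add: linear_add[OF assms(1)] linear_scale[OF assms(1)])
  ultimately show ?case
    by (intro bexI[of _ "\<lambda>s. poly [:1:] s *\<^sub>R y + (s - a) *\<^sub>R g s"]) auto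
qed

lemma poly_maps_extend:
  assumes "f \<in> poly_maps l S"
  obtains g where "g \<in> poly_maps l UNIV" "\<And>s. s \<in> S \<Longrightarrow> f s = g s"
  using assms unfolding poly_maps_def by fastforce

lemma poly_maps_has_vector_derivative:
  assumes "f \<in> poly_maps l UNIV"
  shows "\<exists>f'\<in>poly_maps (l - 1) UNIV. \<forall>s. (f has_vector_derivative f' s) (at s)"
proof -
  obtain c where c: "\<And>s. f s = (\<Sum>n\<le>l. s ^ n *\<^sub>R c n)"
    using assms unfolding poly_maps_def by blast
  define f' where "f' = (\<lambda>s. \<Sum>n\<le>l. poly (pderiv (monom 1 n)) s *\<^sub>R c n)"
  have "f' \<in> poly_maps (l - 1) UNIV"
    unfolding f'_def
    by (intro poly_maps_sum poly_scaleR_in_poly_maps) (auto simp: degree_pderiv degree_monom_eq)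
  moreover have "(f has_vector_derivative f' s) (at s)" for s
  proof -
    have "((\<lambda>s. \<Sum>n\<le>l. poly (monom 1 n) s *\<^sub>R c n) has_vector_derivative f' s) (at s)"
      unfolding f'_def
      by (intro has_vector_derivative_sum)
        (auto intro!: derivative_eq_intros poly_DERIV has_vector_derivative_scaleR[THEN has_vector_derivative_eq_rhs])
    then show ?thesis by (simp add: c[abs_def] poly_monom)
  qed
  ultimately show ?thesis by blast
qed

section \<open>The projection onto polynomials on an interval\<close>

text \<open>The monomials below degree \<open>l\<close> have a dual basis with respect to the
\<open>L\<^sup>2\<close> inner product. The induction is a Gram--Schmidt step: subtracting from
\<open>s\<^sup>l\<close> its projection \<open>\<Sum> M\<^sub>i q\<^sub>i\<close>, where
\<open>M\<^sub>i\<close> is the moment of order \<open>i\<close> of \<open>s\<^sup>l\<close>, leaves a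
polynomial orthogonal to all lower powers. Scaled, it is the new dual element, and the old ones are
corrected by multiples of it. A family of scalar polynomials is enough, whatever the space in which the
functions to be projected take their values.\<close>

lemma moment_dual_basis:
  assumes "a < b"
  shows "\<exists>q :: nat \<Rightarrow> real poly. \<forall>i<l. degree (q i) < l \<and>
    (\<forall>n<l. integral {a..b} (\<lambda>s. s ^ n * poly (q i) s) = (if n = i then 1 else 0))"
proof (induction l)
  case 0
  show ?case by simp
next
  case (Suc l)
  then obtain q :: "nat \<Rightarrow> real poly" where deg: "\<And>i. i < l \<Longrightarrow> degree (q i) < l"
    and dual: "\<And>i n. i < l \<Longrightarrow> n < l \<Longrightarrow>
      integral {a..b} (\<lambda>s. s ^ n * poly (q i) s) = (if n = i then 1 else 0)"
    by blast
  have int: "(\<lambda>s. s ^ n * poly p s) integrable_on {a..b}" for n p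
    by (intro integrable_continuous_real continuous_intros)
  define M where "M n p = integral {a..b} (\<lambda>s. s ^ n * poly p s)" for n p
  have M_diff: "M n (p - p') = M n p - M n p'" for n p p'
    using integral_diff[OF int int] unfolding M_def by (simp add: algebra_simps)
  have M_smult: "M n (smult c p) = c * M n p" for n c p
    unfolding M_def by (simp add: mult.left_commute)
  have M_sum: "M n (\<Sum>i\<in>A. p i) = (\<Sum>i\<in>A. M n (p i))" if "finite A" for n A p
    unfolding M_def by (simp add: poly_sum sum_distrib_left integral_sum[OF that int])
  have dual_M: "M n (q i) = (if n = i then 1 else 0)" if "i < l" "n < l" for i n
    using dual[OF that] by (simp add: M_def)
  have M_monom: "M n (monom 1 p) = M p (monom 1 n)" for n p
    by (simp add: M_def poly_monom mult.commute)
  \<comment> \<open>the component of \<open>s\<^sup>l\<close> orthogonal to all lower powers\<close>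
  define pr where "pr = monom 1 l - (\<Sum>i<l. smult (M i (monom 1 l)) (q i))"
  have orth: "M n pr = 0" if "n < l" for n
    unfolding pr_def M_diff M_sum[OF finite_lessThan] M_smult
    using that by (simp add: dual_M if_distrib M_monom mult.commute cong: if_cong)
  have deg_sum: "degree (\<Sum>i<l. smult (M i (monom 1 l)) (q i)) < l \<or> l = 0"
    by (cases "l = 0") (auto intro!: degree_sum_less order.strict_trans1[OF degree_smult_le] deg)
  have lead: "coeff pr l = 1"
    using deg_sum unfolding pr_def by (auto simp: coeff_eq_0)
  have deg_pr: "degree pr \<le> l"
    unfolding pr_def using deg_sum
    by (intro degree_diff_le) (auto simp: degree_monom_eq)
  \<comment> \<open>As \<open>pr\<close> is monic and orthogonal to lower powers, its moment of order \<open>l\<close> is its squared norm.\<close>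
  have "M l pr \<noteq> 0"
  proof
    assume *: "M l pr = 0"
    have "integral {a..b} (\<lambda>s. poly pr s * poly pr s)
        = integral {a..b} (\<lambda>s. \<Sum>n\<le>l. coeff pr n * (s ^ n * poly pr s))"
    proof -
      have "poly pr s = (\<Sum>n\<le>l. coeff pr n * s ^ n)" for s
        by (subst (1) poly_as_sum_of_monoms'[OF deg_pr, symmetric]) (simp add: poly_sum poly_monom)
      then have "poly pr s * poly pr s = (\<Sum>n\<le>l. coeff pr n * s ^ n) * poly pr s" for s
        by metis
      then show ?thesis by (simp add: sum_distrib_right mult.assoc)
    qed
    also have "\<dots> = (\<Sum>n\<le>l. coeff pr n * M n pr)"
      unfolding M_def by (subst integral_sum) (auto intro!: integrable_continuous_real continuous_intros)
    also have "\<dots> = 0"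
      using orth * by (intro sum.neutral) (auto simp: le_less)
    finally have "\<forall>s\<in>{a..b}. poly pr s * poly pr s = 0"
      by (subst (asm) integral_eq_0_iff) (use assms in \<open>auto intro!: continuous_intros\<close>)
    then have "{a..b} \<subseteq> {s. poly pr s = 0}" by auto
    moreover have "pr \<noteq> 0" using lead by auto
    ultimately have "finite {a..b}" using poly_roots_finite finite_subset by blast
    then show False using assms by (simp add: infinite_Icc)
  qed
  define u where "u = smult (inverse (M l pr)) pr"
  have u: "M n u = (if n = l then 1 else 0)" if "n \<le> l" for n
    using that orth[of n] \<open>M l pr \<noteq> 0\<close> by (auto simp: u_def M_smult)
  have deg_u: "degree u \<le> l" using deg_pr by (simp add: u_def)
  define q' where "q' i = (if i = l then u else q i - smult (M l (q i)) u)" for i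
  have "degree (q' i) < Suc l" if "i < Suc l" for i
    using deg_u deg[of i] that unfolding q'_def
    by (auto simp: less_Suc_eq_le intro!: degree_diff_le order_trans[OF degree_smult_le])
  moreover have "M n (q' i) = (if n = i then 1 else 0)" if "i < Suc l" "n < Suc l" for i n
    using that u[of n] u[of l] dual_M[of i n] unfolding q'_def
    by (auto simp: M_diff M_smult less_Suc_eq)
  ultimately show ?case unfolding M_def by blast
qed

text \<open>With \<open>P = \<Sum> q\<^sub>n v\<^sub>n\<close>, where \<open>v\<^sub>n\<close> is the moment of order \<open>n\<close> of \<open>f\<close>, the maps \<open>P\<close> and \<open>f\<close> have
the same moments up to order \<open>l\<close>. The coefficients \<open>v\<^sub>n\<close> lie in the Banach space \<open>'x\<close> where \<open>f\<close>
takes its values. A bounded linear map into an inner product space commutes with the integrals, so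
that one \<open>P\<close> represents the orthogonal projection of \<open>e \<circ> f\<close> for every such \<open>e\<close>.\<close>

lemma poly_projection_on_interval:
  fixes f :: "real \<Rightarrow> 'x::banach"
  assumes "a < b" and f: "continuous_on {a..b} f"
  shows "\<exists>P\<in>poly_maps l {a..b}. \<forall>e :: 'x \<Rightarrow> 'z::real_inner. \<forall>h\<in>poly_maps l {a..b}. bounded_linear e \<longrightarrow>
    integral {a..b} (\<lambda>s. e (P s) \<bullet> h s) = integral {a..b} (\<lambda>s. e (f s) \<bullet> h s)"
proof -
  obtain q :: "nat \<Rightarrow> real poly" where deg: "\<And>i. i \<le> l \<Longrightarrow> degree (q i) \<le> l"
    and dual: "\<And>i n. i \<le> l \<Longrightarrow> n \<le> l \<Longrightarrow>
      integral {a..b} (\<lambda>s. s ^ n * poly (q i) s) = (if n = i then 1 else 0)"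
    using moment_dual_basis[OF assms(1), of "Suc l"] by (auto simp: less_Suc_eq_le)
  define v where "v i = integral {a..b} (\<lambda>s. s ^ i *\<^sub>R f s)" for i
  define P where "P = (\<lambda>s. \<Sum>i\<le>l. poly (q i) s *\<^sub>R v i)"
  have P: "P \<in> poly_maps l {a..b}"
    unfolding P_def by (intro poly_maps_sum poly_scaleR_in_poly_maps deg) auto
  have moments: "integral {a..b} (\<lambda>s. s ^ n *\<^sub>R P s) = v n" if n: "n \<le> l" for n
  proof -
    have int: "(\<lambda>s. s ^ n * poly (q i) s) integrable_on {a..b}" for i
      by (intro integrable_continuous_real continuous_intros)
    have sc: "((\<lambda>s. (s ^ n * poly (q i) s) *\<^sub>R v i) has_integral
        (integral {a..b} (\<lambda>s. s ^ n * poly (q i) s)) *\<^sub>R v i) {a..b}" for i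
      using has_integral_linear[OF integrable_integral[OF int] bounded_linear_scaleR_left]
      by (simp add: o_def)
    have "((\<lambda>s. \<Sum>i\<le>l. (s ^ n * poly (q i) s) *\<^sub>R v i) has_integral
        (\<Sum>i\<le>l. (integral {a..b} (\<lambda>s. s ^ n * poly (q i) s)) *\<^sub>R v i)) {a..b}"
      by (intro has_integral_sum sc) auto
    also have "(\<Sum>i\<le>l. (integral {a..b} (\<lambda>s. s ^ n * poly (q i) s)) *\<^sub>R v i)
        = (\<Sum>i\<le>l. if n = i then v i else 0)"
      using dual n by (intro sum.cong) auto
    also have "\<dots> = v n" using n by simp
    finally show ?thesis
      by (simp add: P_def scaleR_sum_right integral_unique)
  qed
  have "integral {a..b} (\<lambda>s. e (P s) \<bullet> h s) = integral {a..b} (\<lambda>s. e (f s) \<bullet> h s)"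
    if h: "h \<in> poly_maps l {a..b}" and e: "bounded_linear e" for h and e :: "'x \<Rightarrow> 'z"
  proof -
    obtain c where c: "\<And>s. s \<in> {a..b} \<Longrightarrow> h s = (\<Sum>n\<le>l. s ^ n *\<^sub>R c n)"
      using h unfolding poly_maps_def by blast
    have expand: "integral {a..b} (\<lambda>s. e (g s) \<bullet> h s)
        = (\<Sum>n\<le>l. e (integral {a..b} (\<lambda>s. s ^ n *\<^sub>R g s)) \<bullet> c n)"
      if g: "continuous_on {a..b} g" for g
    proof -
      have bl: "bounded_linear (\<lambda>x. e x \<bullet> c n)" for n
        using bounded_linear_compose[OF bounded_linear_inner_left e] by (simp add: o_def)
      have "((\<lambda>s. e (s ^ n *\<^sub>R g s) \<bullet> c n) has_integral
          e (integral {a..b} (\<lambda>s. s ^ n *\<^sub>R g s)) \<bullet> c n) {a..b}" for n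
      proof -
        have "(\<lambda>s. s ^ n *\<^sub>R g s) integrable_on {a..b}"
          by (intro integrable_continuous_real continuous_intros g)
        from has_integral_linear[OF integrable_integral[OF this] bl[of n]]
        show ?thesis by (simp add: o_def)
      qed
      then have "((\<lambda>s. \<Sum>n\<le>l. e (s ^ n *\<^sub>R g s) \<bullet> c n) has_integral
          (\<Sum>n\<le>l. e (integral {a..b} (\<lambda>s. s ^ n *\<^sub>R g s)) \<bullet> c n)) {a..b}"
        by (intro has_integral_sum) auto
      then have "((\<lambda>s. e (g s) \<bullet> h s) has_integral
          (\<Sum>n\<le>l. e (integral {a..b} (\<lambda>s. s ^ n *\<^sub>R g s)) \<bullet> c n)) {a..b}"
        by (rule has_integral_eq[rotated])
          (simp add: c inner_sum_right linear_scale[OF bounded_linear.linear[OF e]])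
      then show ?thesis by (rule integral_unique)
    qed
    show ?thesis
      using moments by (simp add: expand f poly_maps_continuous_on[OF P] v_def)
  qed
  then show ?thesis using P by blast
qed

section \<open>Functions given piecewise on a grid\<close>

lemma negligible_of_AE_lebesgue_on:
  assumes "AE s in lebesgue_on {a..b::real}. Q s"
  obtains N where "negligible N" "\<And>s. s \<in> {a..b} - N \<Longrightarrow> Q s"
proof -
  have "AE s in lebesgue. s \<in> {a..b} \<longrightarrow> Q s"
    using assms by (subst (asm) AE_restrict_space_iff) auto
  then obtain N where "N \<in> null_sets lebesgue" "{s. \<not> (s \<in> {a..b} \<longrightarrow> Q s)} \<subseteq> N"
    unfolding eventually_ae_filter by auto
  then show thesis using that[of N] by (auto simp: negligible_iff_null_sets)
qed

lemma AE_lebesgue_on_of_negligible: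
  assumes "negligible N" "\<And>s. s \<in> {a..b::real} - N \<Longrightarrow> Q s"
  shows "AE s in lebesgue_on {a..b}. Q s"
proof -
  have "AE s in lebesgue. s \<in> {a..b} \<longrightarrow> Q s"
    unfolding eventually_ae_filter
    using assms by (intro bexI[of _ N]) (auto simp: negligible_iff_null_sets)
  then show ?thesis by (subst AE_restrict_space_iff) auto
qed

lemma continuous_AE_eq_imp_eq:
  fixes f g :: "real \<Rightarrow> 'a::real_normed_vector"
  assumes "a < b" "continuous_on {a..b} f" "continuous_on {a..b} g"
    and "AE s in lebesgue_on {a..b}. f s = g s" "s \<in> {a..b}"
  shows "f s = g s"
proof -
  obtain N where N: "negligible N" "\<And>s. s \<in> {a..b} - N \<Longrightarrow> f s = g s"
    using negligible_of_AE_lebesgue_on[OF assms(4)] by blast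
  have "((\<lambda>s. norm (f s - g s)) has_integral 0) {a..b}"
    by (rule has_integral_spike[OF N(1) _ has_integral_0]) (simp add: N(2))
  then have "integral {a..b} (\<lambda>s. norm (f s - g s)) = 0" by (rule integral_unique)
  then have "\<forall>s\<in>{a..b}. norm (f s - g s) = 0"
    by (subst (asm) integral_eq_0_iff) (use assms in \<open>auto intro!: continuous_intros\<close>)
  then show ?thesis using assms(5) by auto
qed

text \<open>The pieces are continuous up to the boundary of their cells, so everything can be computed with
Henstock--Kurzweil integrals, which are additive over adjacent intervals. Absolute integrability is
carried along in order to return to the Lebesgue integral.\<close>

lemma integral_over_grid:
  fixes \<phi> :: "real \<Rightarrow> real"
  assumes "\<And>i. i < m \<Longrightarrow> t i < t (Suc i)"
    and "\<And>i. i \<in> {1..m} \<Longrightarrow> continuous_on (cell t i) (\<psi> i)"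
    and "\<And>i. i \<in> {1..m} \<Longrightarrow> AE s in lebesgue_on (cell t i). \<phi> s = \<psi> i s"
  shows "(\<integral>s. \<phi> s \<partial>lebesgue_on {t 0..t m}) = (\<Sum>i=1..m. integral (cell t i) (\<psi> i))"
proof -
  have "\<phi> absolutely_integrable_on {t 0..t m} \<and> t 0 \<le> t m \<and>
    (\<phi> has_integral (\<Sum>i=1..m. integral (cell t i) (\<psi> i))) {t 0..t m}"
    using assms
  proof (induction m)
    case 0
    have "(\<lambda>s. 0 :: real) absolutely_integrable_on {t 0..t 0}" by simp
    then have "\<phi> absolutely_integrable_on {t 0..t 0}"
      by (rule absolutely_integrable_spike[of _ _ "{t 0}"]) auto
    then show ?case by (simp add: has_integral_refl)
  next
    case (Suc m)
    let ?J = "{t m..t (Suc m)}"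
    have J: "cell t (Suc m) = ?J" by (simp add: cell_def)
    have IH: "\<phi> absolutely_integrable_on {t 0..t m}" "t 0 \<le> t m"
      "(\<phi> has_integral (\<Sum>i=1..m. integral (cell t i) (\<psi> i))) {t 0..t m}"
      using Suc by auto
    have cont: "continuous_on ?J (\<psi> (Suc m))"
      using Suc.prems(2)[of "Suc m"] J by auto
    have "AE s in lebesgue_on ?J. \<phi> s = \<psi> (Suc m) s"
      using Suc.prems(3)[of "Suc m"] unfolding J by simp
    then obtain N where N: "negligible N" "\<And>s. s \<in> ?J - N \<Longrightarrow> \<phi> s = \<psi> (Suc m) s"
      by (rule negligible_of_AE_lebesgue_on) blast
    have last: "\<phi> absolutely_integrable_on ?J" "(\<phi> has_integral integral ?J (\<psi> (Suc m))) ?J"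
      using absolutely_integrable_spike[OF absolutely_integrable_continuous_real[OF cont] N]
        has_integral_spike[OF N integrable_integral[OF integrable_continuous_real[OF cont]]]
      by auto
    have le: "t m \<le> t (Suc m)" using Suc.prems(1)[of m] by simp
    have "{t 0..t (Suc m)} = {t 0..t m} \<union> ?J"
      using IH(2) le by auto
    then show ?case
      using absolutely_integrable_Un[OF IH(1) last(1)] has_integral_combine[OF IH(2) le IH(3) last(2)]
        IH(2) le J by auto
  qed
  moreover from this have "integrable (lebesgue_on {t 0..t m}) \<phi>"
    by (simp add: absolutely_integrable_imp_integrable)
  ultimately show ?thesis
    by (simp add: lebesgue_integral_eq_integral integral_unique)
qed

lemma grid_le:
  fixes t :: "nat \<Rightarrow> real"
  assumes "\<And>i. i < m \<Longrightarrow> t i < t (Suc i)" "i \<le> j" "j \<le> m"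
  shows "t i \<le> t j"
  using assms(2,3,1)
proof (induction j rule: dec_induct)
  case base
  then show ?case by simp
next
  case (step n)
  have "t n < t (Suc n)" using step.prems by simp
  then show ?case using step by fastforce
qed

lemma cell_overlap:
  assumes "\<And>i. i < m \<Longrightarrow> t i < t (Suc i)" "i \<in> {1..m}" "j \<in> {1..m}" "i \<noteq> j"
  shows "cell t i \<inter> cell t j \<subseteq> {t (i - 1), t i}"
proof (cases "i < j")
  case True
  then have "t i \<le> t (j - 1)" using assms by (intro grid_le[of m]) auto
  then show ?thesis by (auto simp: cell_def)
next
  case False
  then have "t j \<le> t (i - 1)" using assms by (intro grid_le[of m]) auto
  then show ?thesis by (auto simp: cell_def)
qed


lemma pw_polyI:
  assumes "\<And>j. j \<in> {1..m} \<Longrightarrow> p j \<in> poly_maps l (cell t j)"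
    and "\<And>j. j \<in> {1..m} \<Longrightarrow> AE s in lebesgue_on (cell t j). f s = p j s"
  shows "f \<in> pw_poly t m l"
  unfolding pw_poly_def
proof (intro CollectI ballI)
  fix j assume "j \<in> {1..m}"
  then show "\<exists>p\<in>poly_maps l (cell t j). AE s in lebesgue_on (cell t j). f s = p s"
    using assms by (intro bexI[of _ "p j"])
qed

lemma pw_polyE:
  assumes "f \<in> pw_poly t m l"
  obtains p where "\<And>j. j \<in> {1..m} \<Longrightarrow> p j \<in> poly_maps l (cell t j)"
    and "\<And>j. j \<in> {1..m} \<Longrightarrow> AE s in lebesgue_on (cell t j). f s = p j s"
proof -
  have "\<forall>j\<in>{1..m}. \<exists>p. p \<in> poly_maps l (cell t j) \<and> (AE s in lebesgue_on (cell t j). f s = p s)"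
    using assms unfolding pw_poly_def by blast
  from bchoice[OF this] show thesis using that by blast
qed

text \<open>Gluing the local projections gives one function with the defining property of the projection, so
the choice made in its definition is a meaningful one. Any function with this property has the same
pieces: testing with a polynomial on the \<open>i\<close>-th cell, extended by zero, shows that its \<open>i\<close>-th
piece satisfies the local orthogonality relations, and these determine a polynomial uniquely.\<close>

lemma L2_proj_on_cell:
  fixes e :: "'x::banach \<Rightarrow> 'z::real_inner"
  assumes e: "bounded_linear e"
    and grid: "\<And>i. i < m \<Longrightarrow> t i < t (Suc i)"
    and f: "continuous_on {t 0..t m} f"
    and i: "i \<in> {1..m}"
  shows "\<exists>P\<in>poly_maps l (cell t i).
    (\<forall>s\<in>cell t i. poly_restrict l (cell t i) (L2_proj t m l (\<lambda>u. e (f u))) s = e (P s)) \<and>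
    (\<forall>h\<in>poly_maps l (cell t i).
      integral (cell t i) (\<lambda>s. e (P s) \<bullet> h s) = integral (cell t i) (\<lambda>s. e (f s) \<bullet> h s))"
proof -
  have lt: "t (j - 1) < t j" if "j \<in> {1..m}" for j
    using grid[of "j - 1"] that by auto
  have f_cell: "continuous_on (cell t j) f" if "j \<in> {1..m}" for j
  proof (rule continuous_on_subset[OF f])
    show "cell t j \<subseteq> {t 0..t m}"
      using grid_le[where t = t and m = m, OF grid, of 0 "j - 1"] grid_le[where t = t and m = m, OF grid, of j m] that
      by (auto simp: cell_def)
  qed
  have ef_cell: "continuous_on (cell t j) (\<lambda>s. e (f s))" if "j \<in> {1..m}" for j
    by (rule bounded_linear.continuous_on[OF e f_cell[OF that]])
  have "\<exists>P\<in>poly_maps l (cell t j). \<forall>h\<in>poly_maps l (cell t j).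
      integral (cell t j) (\<lambda>s. e (P s) \<bullet> h s) = integral (cell t j) (\<lambda>s. e (f s) \<bullet> h s)"
    if "j \<in> {1..m}" for j
    using poly_projection_on_interval[OF lt[OF that], of f l, where 'z = 'z] f_cell[OF that] e
    unfolding cell_def by blast
  then obtain P where P: "\<And>j. j \<in> {1..m} \<Longrightarrow> P j \<in> poly_maps l (cell t j)"
    and P_orth: "\<And>j h. j \<in> {1..m} \<Longrightarrow> h \<in> poly_maps l (cell t j) \<Longrightarrow>
      integral (cell t j) (\<lambda>s. e (P j s) \<bullet> h s) = integral (cell t j) (\<lambda>s. e (f s) \<bullet> h s)"
    by metis
  have eP: "(\<lambda>s. e (P j s)) \<in> poly_maps l (cell t j)" if "j \<in> {1..m}" for j
    by (rule poly_maps_linear_image[OF bounded_linear.linear[OF e] P[OF that]])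
  have split: "(\<integral>s. u s \<bullet> h s \<partial>lebesgue_on {t 0..t m})
      = (\<Sum>j=1..m. integral (cell t j) (\<lambda>s. v j s \<bullet> hh j s))"
    if "\<And>j. j \<in> {1..m} \<Longrightarrow> continuous_on (cell t j) (v j)"
      "\<And>j. j \<in> {1..m} \<Longrightarrow> continuous_on (cell t j) (hh j)"
      "\<And>j. j \<in> {1..m} \<Longrightarrow> AE s in lebesgue_on (cell t j). u s = v j s"
      "\<And>j. j \<in> {1..m} \<Longrightarrow> AE s in lebesgue_on (cell t j). h s = hh j s"
    for u h :: "real \<Rightarrow> 'z" and v hh
  proof (rule integral_over_grid)
    fix j assume j: "j \<in> {1..m}"
    show "continuous_on (cell t j) (\<lambda>s. v j s \<bullet> hh j s)"
      by (intro continuous_intros that j)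
    show "AE s in lebesgue_on (cell t j). u s \<bullet> h s = v j s \<bullet> hh j s"
      using that(3,4)[OF j] by eventually_elim simp
  qed (rule grid)
  define is_proj where "is_proj g \<longleftrightarrow> g \<in> pw_poly t m l \<and> (\<forall>h\<in>pw_poly t m l.
      (\<integral>s. g s \<bullet> h s \<partial>lebesgue_on {t 0..t m}) = (\<integral>s. e (f s) \<bullet> h s \<partial>lebesgue_on {t 0..t m}))"
    for g :: "real \<Rightarrow> 'z"
  \<comment> \<open>At a grid point \<open>t j\<close> this takes the value from the left, which is immaterial.\<close>
  define g where "g s = e (P (LEAST j. s \<le> t j) s)" for s
  have g_cell: "AE s in lebesgue_on (cell t j). g s = e (P j s)" if j: "j \<in> {1..m}" for j
    unfolding cell_def
  proof (rule AE_lebesgue_on_of_negligible[of "{t (j - 1)}"])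
    fix s assume s: "s \<in> {t (j - 1)..t j} - {t (j - 1)}"
    have "(LEAST j. s \<le> t j) = j"
    proof (rule Least_equality)
      fix n assume n: "s \<le> t n"
      show "j \<le> n"
      proof (rule ccontr)
        assume "\<not> j \<le> n"
        then have "t n \<le> t (j - 1)" using j by (intro grid_le[where t = t and m = m, OF grid]) auto
        then show False using n s by auto
      qed
    qed (use s in auto)
    then show "g s = e (P j s)" by (simp add: g_def)
  qed simp
  have "is_proj g"
    unfolding is_proj_def
  proof (intro conjI ballI)
    show "g \<in> pw_poly t m l"
      by (rule pw_polyI[OF eP g_cell])
    fix h :: "real \<Rightarrow> 'z" assume "h \<in> pw_poly t m l"
    then obtain hh where hh: "\<And>j. j \<in> {1..m} \<Longrightarrow> hh j \<in> poly_maps l (cell t j)"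
      "\<And>j. j \<in> {1..m} \<Longrightarrow> AE s in lebesgue_on (cell t j). h s = hh j s"
      by (rule pw_polyE) blast
    note hh_cont = poly_maps_continuous_on[OF hh(1)]
    have "(\<integral>s. g s \<bullet> h s \<partial>lebesgue_on {t 0..t m})
        = (\<Sum>j=1..m. integral (cell t j) (\<lambda>s. e (P j s) \<bullet> hh j s))"
      by (rule split[OF poly_maps_continuous_on[OF eP] hh_cont g_cell hh(2)])
    also have "\<dots> = (\<Sum>j=1..m. integral (cell t j) (\<lambda>s. e (f s) \<bullet> hh j s))"
      by (intro sum.cong refl P_orth hh)
    also have "\<dots> = (\<integral>s. e (f s) \<bullet> h s \<partial>lebesgue_on {t 0..t m})"
      by (rule split[OF ef_cell hh_cont _ hh(2), symmetric]) simp_all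
    finally show "(\<integral>s. g s \<bullet> h s \<partial>lebesgue_on {t 0..t m})
      = (\<integral>s. e (f s) \<bullet> h s \<partial>lebesgue_on {t 0..t m})" .
  qed
  define G where "G = L2_proj t m l (\<lambda>u. e (f u))"
  have "is_proj G"
    using someI[of is_proj, OF \<open>is_proj g\<close>] unfolding G_def L2_proj_def is_proj_def .
  then obtain p where p: "\<And>j. j \<in> {1..m} \<Longrightarrow> p j \<in> poly_maps l (cell t j)"
    and Gp: "\<And>j. j \<in> {1..m} \<Longrightarrow> AE s in lebesgue_on (cell t j). G s = p j s"
    unfolding is_proj_def by (elim conjE pw_polyE) blast
  have p_orth: "integral (cell t i) (\<lambda>s. p i s \<bullet> h s) = integral (cell t i) (\<lambda>s. e (f s) \<bullet> h s)"
    if h: "h \<in> poly_maps l (cell t i)" for h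
  proof -
    define h0 where "h0 s = (if s \<in> cell t i then h s else 0)" for s
    define hh where "hh j = (if j = i then h else (\<lambda>s. 0))" for j
    have hh: "hh j \<in> poly_maps l (cell t j)" for j
      using h poly_maps_0 by (auto simp: hh_def)
    have h0: "AE s in lebesgue_on (cell t j). h0 s = hh j s" if j: "j \<in> {1..m}" for j
      unfolding cell_def
    proof (rule AE_lebesgue_on_of_negligible[of "{t (i - 1), t i}"])
      fix s assume s: "s \<in> {t (j - 1)..t j} - {t (i - 1), t i}"
      have "s \<in> cell t j" using s unfolding cell_def by blast
      moreover have "s \<notin> cell t i" if "j \<noteq> i"
        using cell_overlap[where t = t and m = m, OF grid i j] that s calculation by blast
      ultimately show "h0 s = hh j s"
        by (auto simp: h0_def hh_def)
    qed (simp add: negligible_insert)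
    have collapse: "(\<Sum>j=1..m. integral (cell t j) (\<lambda>s. v j s \<bullet> hh j s))
        = integral (cell t i) (\<lambda>s. v i s \<bullet> h s)" for v :: "nat \<Rightarrow> real \<Rightarrow> 'z"
    proof -
      have "(\<Sum>j=1..m. integral (cell t j) (\<lambda>s. v j s \<bullet> hh j s))
          = (\<Sum>j=1..m. if j = i then integral (cell t i) (\<lambda>s. v i s \<bullet> h s) else 0)"
        by (intro sum.cong) (auto simp: hh_def)
      then show ?thesis using i by simp
    qed
    have "h0 \<in> pw_poly t m l"
      by (rule pw_polyI[OF hh h0])
    then have "(\<integral>s. G s \<bullet> h0 s \<partial>lebesgue_on {t 0..t m})
        = (\<integral>s. e (f s) \<bullet> h0 s \<partial>lebesgue_on {t 0..t m})"
      using \<open>is_proj G\<close> unfolding is_proj_def by blast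
    moreover have "(\<integral>s. G s \<bullet> h0 s \<partial>lebesgue_on {t 0..t m})
        = (\<Sum>j=1..m. integral (cell t j) (\<lambda>s. p j s \<bullet> hh j s))"
      by (rule split[OF poly_maps_continuous_on[OF p] poly_maps_continuous_on[OF hh] Gp h0])
    moreover have "(\<integral>s. e (f s) \<bullet> h0 s \<partial>lebesgue_on {t 0..t m})
        = (\<Sum>j=1..m. integral (cell t j) (\<lambda>s. e (f s) \<bullet> hh j s))"
      by (rule split[OF ef_cell poly_maps_continuous_on[OF hh] _ h0]) simp_all
    ultimately show ?thesis by (simp only: collapse)
  qed
  have p_eq: "p i s = e (P i s)" if s: "s \<in> cell t i" for s
  proof -
    define d where "d s = p i s - e (P i s)" for s
    have d: "d \<in> poly_maps l (cell t i)"
      unfolding d_def by (intro poly_maps_diff p eP i)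
    note cont = poly_maps_continuous_on[OF d] poly_maps_continuous_on[OF p[OF i]]
      poly_maps_continuous_on[OF eP[OF i]]
    have "integral (cell t i) (\<lambda>s. d s \<bullet> d s)
        = integral (cell t i) (\<lambda>s. p i s \<bullet> d s - e (P i s) \<bullet> d s)"
      by (simp add: d_def[abs_def] inner_diff_left)
    also have "\<dots> = integral (cell t i) (\<lambda>s. p i s \<bullet> d s)
        - integral (cell t i) (\<lambda>s. e (P i s) \<bullet> d s)"
      using cont unfolding cell_def
      by (intro Henstock_Kurzweil_Integration.integral_diff integrable_continuous_real continuous_on_inner)
    also have "\<dots> = 0"
      using p_orth[OF d] P_orth[OF i d] by simp
    finally have "\<forall>s\<in>{t (i - 1)..t i}. d s \<bullet> d s = 0"
      unfolding cell_def
      by (subst (asm) integral_eq_0_iff)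
        (use lt[OF i] cont(1) in \<open>auto simp: cell_def intro!: continuous_on_inner\<close>)
    then show ?thesis using s by (auto simp: cell_def d_def)
  qed
  define R where "R = poly_restrict l (cell t i) G"
  have R: "R \<in> poly_maps l (cell t i) \<and> (AE s in lebesgue_on (cell t i). G s = R s)"
    unfolding R_def poly_restrict_def by (rule someI[of _ "p i"]) (use p Gp i in auto)
  have R_eq: "R s = p i s" if s: "s \<in> cell t i" for s
  proof (rule continuous_AE_eq_imp_eq[OF lt[OF i]])
    show "continuous_on {t (i - 1)..t i} R" "continuous_on {t (i - 1)..t i} (p i)"
      using poly_maps_continuous_on[OF p[OF i]] poly_maps_continuous_on[OF conjunct1[OF R]]
      by (simp_all add: cell_def)
    have "AE s in lebesgue_on (cell t i). R s = p i s"
      using conjunct2[OF R] Gp[OF i] by eventually_elim simp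
    then show "AE s in lebesgue_on {t (i - 1)..t i}. R s = p i s"
      unfolding cell_def .
    show "s \<in> {t (i - 1)..t i}" using s unfolding cell_def .
  qed
  show ?thesis
    using P[OF i] P_orth[OF i] R_eq p_eq unfolding R_def G_def
    by (intro bexI[of _ "P i"]) auto
qed

section \<open>The energy balance\<close>

text \<open>The chain rule needs a derivative of \<open>z\<close> in the norm of \<open>'y\<close>, the space on which \<open>H\<close> is
differentiable. It exists because \<open>z\<close> is the image of a polynomial \<open>y\<close> with values in \<open>'y\<close>. The
representation of \<open>H'\<close> then moves the integrand back to the inner product.\<close>

lemma hamiltonian_increment:
  fixes eX :: "'x::real_normed_vector \<Rightarrow> 'z::real_inner" and eY :: "'y::real_normed_vector \<Rightarrow> 'x"
    and H :: "'y \<Rightarrow> real" and H' :: "'y \<Rightarrow> ('y \<Rightarrow>\<^sub>L real)"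
  assumes "a < b" and eY: "bounded_linear eY" "inj eY"
    and H: "\<And>v. v \<in> D \<Longrightarrow> (H has_derivative blinfun_apply (H' v)) (at v)"
    and z: "z \<in> poly_maps k {a..b}" "\<And>s. s \<in> {a..b} \<Longrightarrow> z s \<in> eY ` D"
    and repr: "\<And>s y. s \<in> {a..b} \<Longrightarrow> blinfun_apply (H' (inv eY (z s))) y = eX (\<eta> s) \<bullet> eX (eY y)"
  shows "\<exists>z'\<in>poly_maps (k - 1) {a..b}.
    (\<forall>s\<in>{a..b}. vector_derivative z (at s within {a..b}) = z' s) \<and>
    ((\<lambda>s. eX (\<eta> s) \<bullet> eX (z' s)) has_integral H (inv eY (z b)) - H (inv eY (z a))) {a..b}"
proof -
  obtain w where w: "w \<in> poly_maps k UNIV" "\<And>s. s \<in> {a..b} \<Longrightarrow> z s = w s"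
    using poly_maps_extend[OF z(1)] by blast
  have "infinite {a..b}" using \<open>a < b\<close> by (simp add: infinite_Icc)
  moreover have "\<And>s. s \<in> {a..b} \<Longrightarrow> w s \<in> range eY" using z(2) w(2) by fastforce
  ultimately obtain y where y: "y \<in> poly_maps k UNIV" "\<And>s. w s = eY (y s)"
    using poly_maps_factor_through_subspace[OF bounded_linear.linear[OF eY(1)] _ w(1)] by blast
  obtain y' where y': "y' \<in> poly_maps (k - 1) UNIV" "\<And>s. (y has_vector_derivative y' s) (at s)"
    using poly_maps_has_vector_derivative[OF y(1)] by blast
  have inv_z: "inv eY (z s) = y s" if "s \<in> {a..b}" for s
    using that by (simp add: w y(2) eY(2))
  have y_D: "y s \<in> D" if "s \<in> {a..b}" for s
    using z(2)[OF that] inv_z[OF that] eY(2) by (auto simp: inv_f_f)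
  have "(\<lambda>s. eY (y' s)) \<in> poly_maps (k - 1) {a..b}"
    using poly_maps_linear_image[OF bounded_linear.linear[OF eY(1)] y'(1)]
    unfolding poly_maps_def by auto
  moreover have "vector_derivative z (at s within {a..b}) = eY (y' s)" if s: "s \<in> {a..b}" for s
  proof -
    have "(w has_vector_derivative eY (y' s)) (at s within {a..b})"
      using bounded_linear.has_vector_derivative[OF eY(1) has_vector_derivative_at_within[OF y'(2)]]
      by (simp add: y(2)[abs_def])
    then have "(z has_vector_derivative eY (y' s)) (at s within {a..b})"
      by (rule has_vector_derivative_transform[rotated 2]) (use s w(2) in auto)
    then show ?thesis
      using vector_derivative_within_cbox[of a b s z] \<open>a < b\<close> s by simp
  qed
  moreover have "((\<lambda>s. eX (\<eta> s) \<bullet> eX (eY (y' s))) has_integral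
      H (inv eY (z b)) - H (inv eY (z a))) {a..b}"
  proof -
    have "((H \<circ> y) has_vector_derivative eX (\<eta> s) \<bullet> eX (eY (y' s))) (at s within {a..b})"
      if s: "s \<in> {a..b}" for s
      using vector_derivative_diff_chain_within[OF has_vector_derivative_at_within[OF y'(2)]
          has_derivative_at_withinI[OF H[OF y_D[OF s]]]] repr[OF s] inv_z[OF s] by simp
    from fundamental_theorem_of_calculus[OF _ this] show ?thesis
      using \<open>a < b\<close> inv_z by simp
  qed
  ultimately show ?thesis by (intro bexI[of _ "\<lambda>s. eY (y' s)"]) auto
qed

theorem proposition3p5:
  fixes eX :: "'x::banach \<Rightarrow> 'z::{real_inner, complete_space}"
    and eY :: "'y::banach \<Rightarrow> 'x"
    and T :: real and z0 :: 'x
    and D :: "'y set" and H :: "'y \<Rightarrow> real" and H' :: "'y \<Rightarrow> ('y \<Rightarrow>\<^sub>L real)"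
    and j r :: "'x \<Rightarrow> 'x \<Rightarrow> real" and b :: "real \<Rightarrow> 'x \<Rightarrow> 'x \<Rightarrow> real"
    and p c :: real and bb :: "real \<Rightarrow> real"
    and t :: "nat \<Rightarrow> real" and m :: nat
    and sQ :: nat and \<omega> \<zeta> :: "nat \<Rightarrow> real"
    and k :: nat and z :: "real \<Rightarrow> 'x" and \<eta>z :: "real \<Rightarrow> 'x"
  assumes Z_separable: "separable_space (euclidean :: 'z topology)"
    and X_reflexive: "reflexive_space TYPE('x)"
    and X_in_Z: "dense_embedding eX"
    and Y_in_X: "cont_embedding eY"
    and T_pos: "T > 0"
    and D_open: "open D"
    and H_deriv: "\<And>v. v \<in> D \<Longrightarrow> (H has_derivative blinfun_apply (H' v)) (at v)"
    and H_C1: "continuous_on D H'"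
    and j_linear: "\<And>v. linear (j v)"
    and j_lipschitz: "\<And>v. \<exists>L. L-lipschitz_on UNIV (j v)"
    and j_cont: "\<And>w. continuous_on UNIV (\<lambda>v. j v w)"
    and r_linear: "\<And>v. linear (r v)"
    and r_lipschitz: "\<And>v. \<exists>L. L-lipschitz_on UNIV (r v)"
    and r_cont: "\<And>w. continuous_on UNIV (\<lambda>v. r v w)"
    and b_linear: "\<And>s v. s \<in> {0..T} \<Longrightarrow> linear (b s v)"
    and b_lipschitz: "\<And>s v. s \<in> {0..T} \<Longrightarrow> \<exists>L. L-lipschitz_on UNIV (b s v)"
    and b_cont: "\<And>w. continuous_on ({0..T} \<times> UNIV) (\<lambda>(s, v). b s v w)"
    and p_gt_1: "p > 1"
    and bb_cont: "continuous_on {0..T} bb"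
    and c_pos: "c > 0"
    and growth: "\<And>s v w. s \<in> {0..T} \<Longrightarrow>
          \<bar>j v w\<bar> + \<bar>r v w\<bar> + \<bar>b s v w\<bar> \<le> c * (bb s + norm v powr (p - 1)) * norm w"
    and j_skew: "\<And>v. j v v = 0"
    and r_nonneg: "\<And>v. r v v \<ge> 0"
    and grid_start: "t 0 = 0"
    and grid_end: "t m = T"
    and grid_mono: "\<And>i. i < m \<Longrightarrow> t i < t (Suc i)"
    and weights_pos: "\<And>n. n \<in> {1..sQ} \<Longrightarrow> \<omega> n > 0"
    and weights_sum: "(\<Sum>n=1..sQ. \<omega> n) = 1"
    and nodes: "\<And>n. n \<in> {1..sQ} \<Longrightarrow> \<zeta> n \<in> {0..1}"
    and sQ_pos: "sQ \<ge> 1"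
    and k_pos: "k \<ge> 1"
    and z_space: "z \<in> pw_poly_cont t m k"
    and z_in_D: "\<And>s. s \<in> {0..T} \<Longrightarrow> z s \<in> eY ` D"
    and \<eta>z_repr: "\<And>s y. s \<in> {0..T} \<Longrightarrow>
          blinfun_apply (H' (inv eY (z s))) y = eX (\<eta>z s) \<bullet> eX (eY y)"
    and \<eta>z_cont: "continuous_on {0..T} \<eta>z"
    and z_init: "z 0 = z0"
    and scheme: "\<And>i \<phi>. \<lbrakk>i \<in> {1..m}; \<phi> \<in> poly_maps (k - 1) (cell t i)\<rbrakk> \<Longrightarrow>
          (\<integral>s. eX (vector_derivative z (at s within cell t i)) \<bullet> eX (\<phi> s) \<partial>lebesgue_on (cell t i)) =
          quad t sQ \<omega> \<zeta> i (\<lambda>s. let w = proj_cell eX t m (k - 1) \<eta>z i s in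
            j w (\<phi> s) - r w (\<phi> s) + b s w (\<phi> s))"
  shows "\<forall>i\<in>{1..m}.
      H (inv eY (z (t i))) - H (inv eY (z (t (i - 1)))) =
        quad t sQ \<omega> \<zeta> i (\<lambda>s. let w = proj_cell eX t m (k - 1) \<eta>z i s in - r w w + b s w w) \<and>
      quad t sQ \<omega> \<zeta> i (\<lambda>s. let w = proj_cell eX t m (k - 1) \<eta>z i s in - r w w + b s w w) \<le>
        quad t sQ \<omega> \<zeta> i (\<lambda>s. let w = proj_cell eX t m (k - 1) \<eta>z i s in b s w w)"
proof
  fix i assume i: "i \<in> {1..m}"
  define w where "w = proj_cell eX t m (k - 1) \<eta>z i"
  have eX: "bounded_linear eX" "inj eX" and eY: "bounded_linear eY" "inj eY"
    using X_in_Z Y_in_X by (auto simp: dense_embedding_def cont_embedding_def)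
  have lt: "t (i - 1) < t i" using grid_mono[of "i - 1"] i by auto
  have cell_T: "cell t i \<subseteq> {0..T}"
    using grid_le[where t = t and m = m, OF grid_mono, of 0 "i - 1"]
      grid_le[where t = t and m = m, OF grid_mono, of i m] i grid_start grid_end
    by (auto simp: cell_def)
  obtain p where p: "p \<in> poly_maps k (cell t i)" "AE s in lebesgue_on (cell t i). z s = p s"
    using z_space i unfolding pw_poly_cont_def pw_poly_def by blast
  have "continuous_on {0..T} z"
    using z_space by (simp add: pw_poly_cont_def grid_start grid_end)
  then have "continuous_on (cell t i) z"
    by (rule continuous_on_subset[OF _ cell_T])
  then have "z s = p s" if "s \<in> cell t i" for s
    using continuous_AE_eq_imp_eq[OF lt, of z p s] p poly_maps_continuous_on[OF p(1)] that
    unfolding cell_def by blast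
  then have z_poly: "z \<in> poly_maps k (cell t i)"
    using poly_maps_cong[OF p(1)] by blast
  have "\<exists>z'\<in>poly_maps (k - 1) {t (i - 1)..t i}.
    (\<forall>s\<in>{t (i - 1)..t i}. vector_derivative z (at s within {t (i - 1)..t i}) = z' s) \<and>
    ((\<lambda>s. eX (\<eta>z s) \<bullet> eX (z' s)) has_integral
      H (inv eY (z (t i))) - H (inv eY (z (t (i - 1))))) {t (i - 1)..t i}"
  proof (rule hamiltonian_increment[OF lt eY H_deriv])
    fix s assume "s \<in> {t (i - 1)..t i}"
    then have s: "s \<in> {0..T}" using cell_T by (auto simp: cell_def)
    show "z s \<in> eY ` D" by (rule z_in_D[OF s])
    show "blinfun_apply (H' (inv eY (z s))) y = eX (\<eta>z s) \<bullet> eX (eY y)" for y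
      by (rule \<eta>z_repr[OF s])
  qed (use z_poly in \<open>simp_all add: cell_def\<close>)
  then obtain z' where z': "z' \<in> poly_maps (k - 1) (cell t i)"
    "\<And>s. s \<in> cell t i \<Longrightarrow> vector_derivative z (at s within cell t i) = z' s"
    and increment: "((\<lambda>s. eX (\<eta>z s) \<bullet> eX (z' s)) has_integral
      H (inv eY (z (t i))) - H (inv eY (z (t (i - 1))))) (cell t i)"
    unfolding cell_def[symmetric] by blast
  obtain P where P: "P \<in> poly_maps (k - 1) (cell t i)"
    and restr: "\<And>s. s \<in> cell t i \<Longrightarrow>
      poly_restrict (k - 1) (cell t i) (L2_proj t m (k - 1) (\<lambda>u. eX (\<eta>z u))) s = eX (P s)"
    and orth: "\<And>h. h \<in> poly_maps (k - 1) (cell t i) \<Longrightarrow>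
      integral (cell t i) (\<lambda>s. eX (P s) \<bullet> h s) = integral (cell t i) (\<lambda>s. eX (\<eta>z s) \<bullet> h s)"
    using L2_proj_on_cell[where t = t and m = m and f = \<eta>z and l = "k - 1",
        OF eX(1) grid_mono _ i] \<eta>z_cont
    unfolding grid_start grid_end by blast
  have wP: "w s = P s" if "s \<in> cell t i" for s
    using restr[OF that] eX(2) by (simp add: w_def proj_cell_def)
  have w: "w \<in> poly_maps (k - 1) (cell t i)"
    using poly_maps_cong[OF P wP] .
  have lin: "linear eX" using eX(1) by (rule bounded_linear.linear)
  have cont: "continuous_on (cell t i) (\<lambda>s. eX (z' s) \<bullet> eX (P s))"
    by (intro continuous_on_inner poly_maps_continuous_on[OF poly_maps_linear_image[OF lin z'(1)]]
        poly_maps_continuous_on[OF poly_maps_linear_image[OF lin P]])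
  \<comment> \<open>The scheme is tested with \<open>w\<close>; the projection error of \<open>\<eta>z\<close> is orthogonal to \<open>z'\<close>.\<close>
  have "(\<integral>s. eX (vector_derivative z (at s within cell t i)) \<bullet> eX (w s) \<partial>lebesgue_on (cell t i))
      = (\<integral>s. eX (z' s) \<bullet> eX (P s) \<partial>lebesgue_on (cell t i))"
    by (rule Bochner_Integration.integral_cong) (auto simp: z'(2) wP)
  also have "\<dots> = integral (cell t i) (\<lambda>s. eX (z' s) \<bullet> eX (P s))"
    using cont unfolding cell_def
    by (intro lebesgue_integral_eq_integral continuous_imp_integrable_real) auto
  also have "\<dots> = integral (cell t i) (\<lambda>s. eX (P s) \<bullet> eX (z' s))"
    by (simp add: inner_commute)
  also have "\<dots> = integral (cell t i) (\<lambda>s. eX (\<eta>z s) \<bullet> eX (z' s))"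
    by (rule orth[OF poly_maps_linear_image[OF lin z'(1)]])
  also have "\<dots> = H (inv eY (z (t i))) - H (inv eY (z (t (i - 1))))"
    using increment by (rule integral_unique)
  finally have balance: "H (inv eY (z (t i))) - H (inv eY (z (t (i - 1))))
      = quad t sQ \<omega> \<zeta> i (\<lambda>s. - r (w s) (w s) + b s (w s) (w s))"
    using scheme[OF i w] by (simp add: w_def j_skew Let_def)
  have "quad t sQ \<omega> \<zeta> i (\<lambda>s. - r (w s) (w s) + b s (w s) (w s))
      \<le> quad t sQ \<omega> \<zeta> i (\<lambda>s. b s (w s) (w s))"
    unfolding quad_def using lt weights_pos r_nonneg
    by (intro mult_left_mono sum_mono) (auto simp: less_imp_le)
  with balance show "H (inv eY (z (t i))) - H (inv eY (z (t (i - 1)))) =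
        quad t sQ \<omega> \<zeta> i (\<lambda>s. let w = proj_cell eX t m (k - 1) \<eta>z i s in - r w w + b s w w) \<and>
      quad t sQ \<omega> \<zeta> i (\<lambda>s. let w = proj_cell eX t m (k - 1) \<eta>z i s in - r w w + b s w w) \<le>
        quad t sQ \<omega> \<zeta> i (\<lambda>s. let w = proj_cell eX t m (k - 1) \<eta>z i s in b s w w)"
    by (simp add: w_def Let_def)
qed

end
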